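(* Let $\vartheta$ be a compatible primitive irreducible Pisot random substitution. Then the RS-subshift $X_\vartheta$ is $C$-balanced for some $C$.
   Context: $\mathcal{A}=\{a_1,\dots,a_d\}$ is a finite alphabet, $\mathcal{A}^+$ the set of non-empty finite words over $\mathcal{A}$, $|w|$ the length of $w$, $|w|_a$ the number of occurrences of the letter $a$ in $w$. A random substitution $\vartheta$ assigns to each $a\in\mathcal{A}$ a non-empty finite set $\vartheta(a)\subset\mathcal{A}^+$. It extends to words by $\vartheta(v_1\cdots v_m)=\{w_1\cdots w_m : w_i\in\vartheta(v_i)\}$ and to sets of words by $\vartheta(B)=\bigcup_{w\in B}\vartheta(w)$, so the powers $\vartheta^k$ are defined. A word is $\vartheta$-legal if it is a (contiguous) subword of some element of $\vartheta^k(a)$ for some $k\ge 1$, $a\in\mathcal{A}$. The RS-subshift $X_\vartheta\subset\mathcal{A}^{\mathbb{Z}}$ is the set of bi-infinite sequences all of whose finite subwords are $\vartheta$-legal. $\vartheta$ is compatible if, for each $a\in\mathcal{A}$, all words in $\vartheta(a)$ have the same number of occurrences of each letter. Then the substitution matrix $M_\vartheta$ has $(i,j)$ entry equal to the common number of $a_i$'s in the words of $\vartheta(a_j)$. $\vartheta$ is primitive if some power of $M_\vartheta$ has all entries positive; then $\lambda_1$ denotes the Perron–Frobenius eigenvalue of $M_\vartheta$. $\vartheta$ is Pisot if $\lambda_1$ is a Pisot number: an algebraic integer greater than $1$ all of whose other algebraic conjugates lie in the open unit disk. $\vartheta$ is irreducible if the characteristic polynomial of $M_\vartheta$ is irreducible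 (over $\mathbb{Q}$). A subshift $X$ with language $\mathcal{L}(X)$ (the set of finite subwords of elements of $X$) is $C$-balanced if there is a constant $C$ such that $\big||w|_a-|w'|_a\big|\le C$ for every letter $a$ and all $w,w'\in\mathcal{L}(X)$ with $|w|=|w'|$. *)

theory Defs
  imports
    "HOL-Library.Sublist"
    "HOL-Computational_Algebra.Computational_Algebra"
    "Jordan_Normal_Form.Char_Poly"
begin

(* The list as = [a_1, ..., a_d] enumerates the alphabet without repetition;
   it fixes the indexing of the substitution matrix. *)
definition random_substitution :: "'a list \<Rightarrow> ('a \<Rightarrow> 'a list set) \<Rightarrow> bool" where
  "random_substitution as \<theta> \<longleftrightarrow> distinct as \<and> as \<noteq> [] \<and>
     (\<forall>a\<in>set as. finite (\<theta> a) \<and> \<theta> a \<noteq> {} \<and> \<theta> a \<subseteq> lists (set as) - {[]})"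

definition subst_word :: "('a \<Rightarrow> 'a list set) \<Rightarrow> 'a list \<Rightarrow> 'a list set" where
  "subst_word \<theta> v = concat ` listset (map \<theta> v)"

definition subst_words :: "('a \<Rightarrow> 'a list set) \<Rightarrow> 'a list set \<Rightarrow> 'a list set" where
  "subst_words \<theta> B = (\<Union>w\<in>B. subst_word \<theta> w)"

definition legal :: "'a list \<Rightarrow> ('a \<Rightarrow> 'a list set) \<Rightarrow> 'a list \<Rightarrow> bool" where
  "legal as \<theta> w \<longleftrightarrow>
     (\<exists>k\<ge>1. \<exists>a\<in>set as. \<exists>u\<in>(subst_words \<theta> ^^ k) {[a]}. sublist w u)"

definition factor :: "(int \<Rightarrow> 'a) \<Rightarrow> int \<Rightarrow> nat \<Rightarrow> 'a list" where
  "factor x i n = map (\<lambda>j. x (i + int j)) [0..<n]"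

definition language :: "(int \<Rightarrow> 'a) set \<Rightarrow> 'a list set" where
  "language X = {factor x i n | x i n. x \<in> X}"

definition rs_subshift :: "'a list \<Rightarrow> ('a \<Rightarrow> 'a list set) \<Rightarrow> (int \<Rightarrow> 'a) set" where
  "rs_subshift as \<theta> =
     {x. range x \<subseteq> set as \<and> (\<forall>i n. legal as \<theta> (factor x i n))}"

definition compatible :: "'a list \<Rightarrow> ('a \<Rightarrow> 'a list set) \<Rightarrow> bool" where
  "compatible as \<theta> \<longleftrightarrow>
     (\<forall>a\<in>set as. \<forall>u\<in>\<theta> a. \<forall>v\<in>\<theta> a. \<forall>b\<in>set as. count_list u b = count_list v b)"

(* Only meaningful for a compatible random substitution, where the common
   number of occurrences exists and is unique. *)
definition subst_mat :: "'a list \<Rightarrow> ('a \<Rightarrow> 'a list set) \<Rightarrow> nat mat" where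
  "subst_mat as \<theta> = mat (length as) (length as)
     (\<lambda>(i, j). THE n. \<forall>w\<in>\<theta> (as ! j). count_list w (as ! i) = n)"

definition primitive_mat :: "nat mat \<Rightarrow> bool" where
  "primitive_mat M \<longleftrightarrow>
     (\<exists>k\<ge>1. \<forall>i<dim_row M. \<forall>j<dim_col M. (M ^\<^sub>m k) $$ (i, j) > 0)"

definition perron_frobenius_eigenvalue :: "nat mat \<Rightarrow> real \<Rightarrow> bool" where
  "perron_frobenius_eigenvalue M l \<longleftrightarrow> l > 0 \<and>
     eigenvalue (map_mat of_nat M :: complex mat) (of_real l) \<and>
     (\<forall>\<mu>. eigenvalue (map_mat of_nat M) \<mu> \<and> \<mu> \<noteq> of_real l \<longrightarrow> cmod \<mu> < l)"

lemma perron_frobenius_eigenvalue_unique: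
  assumes "perron_frobenius_eigenvalue M l" and "perron_frobenius_eigenvalue M l'"
  shows "l = l'"
proof (rule ccontr)
  assume "l \<noteq> l'"
  then have "complex_of_real l' \<noteq> of_real l" and "complex_of_real l \<noteq> of_real l'"
    by simp_all
  with assms have "cmod (of_real l') < l" and "cmod (of_real l) < l'"
    unfolding perron_frobenius_eigenvalue_def by blast+
  then show False by simp
qed

definition minimal_poly :: "complex \<Rightarrow> rat poly \<Rightarrow> bool" where
  "minimal_poly z p \<longleftrightarrow> lead_coeff p = 1 \<and> irreducible p \<and> poly (map_poly of_rat p) z = 0"

definition algebraic_conjugate :: "complex \<Rightarrow> complex \<Rightarrow> bool" where
  "algebraic_conjugate z y \<longleftrightarrow> (\<exists>p. minimal_poly z p \<and> poly (map_poly of_rat p) y = 0)"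

definition pisot_number :: "real \<Rightarrow> bool" where
  "pisot_number l \<longleftrightarrow> algebraic_int l \<and> l > 1 \<and>
     (\<forall>y. algebraic_conjugate (of_real l) y \<and> y \<noteq> of_real l \<longrightarrow> cmod y < 1)"

definition primitive_subst :: "'a list \<Rightarrow> ('a \<Rightarrow> 'a list set) \<Rightarrow> bool" where
  "primitive_subst as \<theta> \<longleftrightarrow> primitive_mat (subst_mat as \<theta>)"

(* For a primitive matrix the eigenvalue l exists by the Perron-Frobenius theorem
   and it is unique by the lemma above. *)
definition pisot_subst :: "'a list \<Rightarrow> ('a \<Rightarrow> 'a list set) \<Rightarrow> bool" where
  "pisot_subst as \<theta> \<longleftrightarrow>
     (\<exists>l. perron_frobenius_eigenvalue (subst_mat as \<theta>) l \<and> pisot_number l)"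

definition irreducible_subst :: "'a list \<Rightarrow> ('a \<Rightarrow> 'a list set) \<Rightarrow> bool" where
  "irreducible_subst as \<theta> \<longleftrightarrow>
     irreducible (char_poly (map_mat of_nat (subst_mat as \<theta>) :: rat mat))"

definition balanced :: "'a list \<Rightarrow> (int \<Rightarrow> 'a) set \<Rightarrow> real \<Rightarrow> bool" where
  "balanced as X C \<longleftrightarrow>
     (\<forall>a\<in>set as. \<forall>w\<in>language X. \<forall>w'\<in>language X. length w = length w' \<longrightarrow>
        \<bar>real (count_list w a) - real (count_list w' a)\<bar> \<le> C)"

end

theory Submission
  imports Defs "Jordan_Normal_Form.Schur_Decomposition"
    "HOL-Computational_Algebra.Field_as_Ring"
begin

text \<open>
  Give every letter a complex weight and weigh a word by the sum over its letters.  Compatibility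
  makes the weight of a word in \<open>\<theta>(v)\<close> a function of \<open>v\<close> alone: substituting
  acts on weights, viewed as row vectors, as right multiplication by the substitution matrix
  \<open>M\<close>.  The proof asks which weights stay bounded on all factors of all words in
  \<open>\<theta>\<^sup>k(a)\<close>.

  A factor of a word in \<open>\<theta>(u)\<close> is an element of \<open>\<theta>(v)\<close> for a factor \<open>v\<close> of
  \<open>u\<close>, up to a prefix and a suffix of bounded length
  (\<open>sublist_subst_word_desubstitute\<close>).  So if substituting turns the weight \<open>\<phi>\<close> into
  \<open>\<mu> \<phi> + \<psi>\<close> with \<open>|\<mu>| < 1\<close> and \<open>\<psi>\<close> bounded on factors, then passing from
  \<open>v\<close> to the factor multiplies the \<open>\<phi>\<close>-weight by \<open>\<mu>\<close> and adds a bounded error, and a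
  geometric series bounds \<open>\<phi>\<close> on factors (\<open>bounded_weight_contraction\<close>).

  The spectrum of \<open>M\<close> is made for this lemma.  The irreducible characteristic polynomial is the
  minimal polynomial of \<open>\<lambda>\<^sub>1\<close>, so its roots are \<open>\<lambda>\<^sub>1\<close>, occurring once, and proper conjugates of
  \<open>\<lambda>\<^sub>1\<close>, which lie in the open unit disk by the Pisot property
  (\<open>pisot_char_poly_factorization\<close>).  A Schur triangularisation that puts \<open>\<lambda>\<^sub>1\<close> first
  yields a basis \<open>q\<^sub>0, ..., q\<^sub>d\<^sub>-\<^sub>1\<close> of the space of weights such that \<open>q\<^sub>i M\<close> is an
  eigenvalue multiple of \<open>q\<^sub>i\<close> plus a combination of later \<open>q\<^sub>m\<close>.  Descending from the last
  index, the contraction lemma bounds every \<open>q\<^sub>i\<close> except \<open>q\<^sub>0\<close> (\<open>weight_basis\<close>).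

  The bounded weights therefore have codimension at most one.  If the constant weight
  \<open>1\<close>, which measures length, is bounded, then factors have bounded length and every weight is
  bounded.  Otherwise every weight is a multiple of \<open>1\<close> plus a bounded weight.
  Either way, counting a letter \<open>a\<close> in a factor \<open>w\<close> gives
  \<open>t\<^sub>a |w|\<close> up to a bounded error (\<open>letter_frequency\<close>), and for two words of the same length
  the main terms cancel.
\<close>

section \<open>Factors of inflation words\<close>

text \<open>
  Recording the level \<open>k\<close>, and starting with single letters at level \<open>0\<close>, lets the estimates
  below run by induction on \<open>k\<close>.
\<close>

definition inflation_factors :: "'a list \<Rightarrow> ('a \<Rightarrow> 'a list set) \<Rightarrow> nat \<Rightarrow> 'a list set" where
  "inflation_factors as \<theta> k =
     {w. \<exists>a\<in>set as. \<exists>u\<in>(subst_words \<theta> ^^ k) {[a]}. sublist w u}"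

lemma subst_word_iff:
  "u \<in> subst_word \<theta> v \<longleftrightarrow> (\<exists>us. list_all2 (\<lambda>x b. x \<in> \<theta> b) us v \<and> u = concat us)"
proof -
  have "us \<in> listset (map \<theta> v) \<longleftrightarrow> list_all2 (\<lambda>x b. x \<in> \<theta> b) us v" for us
    by (induction v arbitrary: us) (auto simp: set_Cons_def list_all2_Cons2)
  then show ?thesis
    unfolding subst_word_def by auto
qed

lemma subst_words_iff: "u \<in> subst_words \<theta> B \<longleftrightarrow> (\<exists>v\<in>B. u \<in> subst_word \<theta> v)"
  by (simp add: subst_words_def)

text \<open>
  The cut that starts \<open>w\<close> falls inside one block; what is left of that block is the short word
  \<open>s\<close>, and the blocks after it are intact.
\<close>

lemma suffix_concat_blocks:
  assumes "list_all2 R us v" "\<forall>u\<in>set us. length u \<le> N" "suffix w (concat us)"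
  shows "\<exists>s us' v'. w = s @ concat us' \<and> length s \<le> N \<and> list_all2 R us' v'
           \<and> suffix v' v \<and> set us' \<subseteq> set us"
  using assms
proof (induction us v rule: list_all2_induct)
  case Nil
  then show ?case by auto
next
  case (Cons u us b v)
  from Cons.prems(2) consider "suffix w (concat us)"
    | s where "w = s @ concat us" "suffix s u"
    by (auto simp: suffix_append)
  then show ?case
  proof cases
    case 1
    with Cons.IH Cons.prems(1) obtain s us' v' where
      "w = s @ concat us'" "length s \<le> N" "list_all2 R us' v'" "suffix v' v" "set us' \<subseteq> set us"
      by auto
    then show ?thesis
      by (intro exI[of _ s] exI[of _ us'] exI[of _ v']) (auto intro: suffix_ConsI)
  next
    case 2
    then have "length s \<le> N"
      using Cons.prems(1) by (auto dest: suffix_length_le)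
    then show ?thesis
      using 2 Cons.hyps by (intro exI[of _ s] exI[of _ us] exI[of _ v]) (auto intro: suffix_ConsI)
  qed
qed

lemma prefix_concat_blocks:
  assumes "list_all2 R us v" "\<forall>u\<in>set us. length u \<le> N" "prefix w (concat us)"
  shows "\<exists>p us' v'. w = concat us' @ p \<and> length p \<le> N \<and> list_all2 R us' v' \<and> prefix v' v"
  using assms
proof (induction us v arbitrary: w rule: list_all2_induct)
  case Nil
  then show ?case by auto
next
  case (Cons u us b v)
  from Cons.prems(2) consider "prefix w u" | w' where "w = u @ w'" "prefix w' (concat us)"
    by (auto simp: prefix_append)
  then show ?case
  proof cases
    case 1
    then have "length w \<le> N"
      using Cons.prems(1) by (auto dest: prefix_length_le)
    then show ?thesis
      by (intro exI[of _ w] exI[of _ "[]"]) auto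
  next
    case 2
    with Cons.IH[of w'] Cons.prems(1) obtain p us' v' where
      "w' = concat us' @ p" "length p \<le> N" "list_all2 R us' v'" "prefix v' v"
      by auto
    with 2 Cons.hyps show ?thesis
      by (intro exI[of _ p] exI[of _ "u # us'"] exI[of _ "b # v'"]) auto
  qed
qed

text \<open>
  A factor of a concatenation of blocks is a prefix of a suffix, so at most its first and last
  blocks are cut.  A factor inside a single block is all \<open>s\<close>, with \<open>v'\<close> empty.
\<close>

lemma sublist_subst_word_desubstitute:
  assumes N: "\<forall>b\<in>set v. \<forall>u\<in>\<theta> b. length u \<le> N"
    and u: "u \<in> subst_word \<theta> v" and w: "sublist w u"
  shows "\<exists>s x p v'. w = s @ x @ p \<and> length s \<le> N \<and> length p \<le> N
           \<and> x \<in> subst_word \<theta> v' \<and> sublist v' v"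
proof -
  obtain us where us: "list_all2 (\<lambda>x b. x \<in> \<theta> b) us v" "u = concat us"
    using u by (auto simp: subst_word_iff)
  have len: "\<forall>u\<in>set us. length u \<le> N"
    using us(1) N by (auto simp: list_all2_conv_all_nth all_set_conv_all_nth)
  obtain y where y: "suffix y (concat us)" "prefix w y"
    using w us(2) by (auto simp: sublist_altdef')
  obtain s us1 v1 where 1: "y = s @ concat us1" "length s \<le> N"
    "list_all2 (\<lambda>x b. x \<in> \<theta> b) us1 v1" "suffix v1 v" "set us1 \<subseteq> set us"
    using suffix_concat_blocks[OF us(1) len y(1)] by blast
  from y(2) consider "prefix w s" | w' where "w = s @ w'" "prefix w' (concat us1)"
    by (auto simp: 1(1) prefix_append)
  then show ?thesis
  proof cases
    case 1
    then have "length w \<le> N"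
      using \<open>length s \<le> N\<close> prefix_length_le by fastforce
    then show ?thesis
      by (intro exI[of _ w] exI[of _ "[]"]) (auto simp: subst_word_iff)
  next
    case 2
    have len1: "\<forall>u\<in>set us1. length u \<le> N"
      using len 1(5) by blast
    obtain p us2 v2 where "w' = concat us2 @ p" "length p \<le> N"
      "list_all2 (\<lambda>x b. x \<in> \<theta> b) us2 v2" "prefix v2 v1"
      using prefix_concat_blocks[OF 1(3) len1 2(2)] by blast
    moreover from this 1(4) have "sublist v2 v"
      unfolding sublist_altdef' by blast
    ultimately show ?thesis
      using 2(1) 1(2) subst_word_iff by metis
  qed
qed

lemma inflation_factors_alphabet:
  assumes "random_substitution as \<theta>" "w \<in> inflation_factors as \<theta> k"
  shows "set w \<subseteq> set as"
proof -
  have "set u \<subseteq> set as" if "a \<in> set as" "u \<in> (subst_words \<theta> ^^ k) {[a]}" for a u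
    using that(2)
  proof (induction k arbitrary: u)
    case 0
    then show ?case using that(1) by auto
  next
    case (Suc k)
    then obtain v where v: "v \<in> (subst_words \<theta> ^^ k) {[a]}" "u \<in> subst_word \<theta> v"
      by (auto simp: subst_words_iff)
    then obtain us where us: "list_all2 (\<lambda>x b. x \<in> \<theta> b) us v" "u = concat us"
      by (auto simp: subst_word_iff)
    have "set x \<subseteq> set as" if x: "x \<in> set us" for x
    proof -
      obtain b where "b \<in> set v" "x \<in> \<theta> b"
        using us(1) x by (metis in_set_conv_nth list_all2_conv_all_nth)
      then show ?thesis
        using Suc.IH[OF v(1)] assms(1) by (fastforce simp: random_substitution_def)
    qed
    then show ?case using us(2) by auto
  qed
  then show ?thesis
    using assms(2) set_mono_sublist unfolding inflation_factors_def by fastforce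
qed

lemma image_lengths_bounded:
  assumes "random_substitution as \<theta>"
  shows "\<exists>N. \<forall>b\<in>set as. \<forall>u\<in>\<theta> b. length u \<le> N"
proof -
  have "finite (length ` (\<Union>b\<in>set as. \<theta> b))"
    using assms by (auto simp: random_substitution_def)
  then show ?thesis
    by (meson UN_I finite_nat_set_iff_bounded_le image_eqI)
qed

lemma inflation_factors_Suc:
  assumes rs: "random_substitution as \<theta>" and N: "\<forall>b\<in>set as. \<forall>u\<in>\<theta> b. length u \<le> N"
    and w: "w \<in> inflation_factors as \<theta> (Suc k)"
  shows "\<exists>s x p v. w = s @ x @ p \<and> length s \<le> N \<and> length p \<le> N
           \<and> x \<in> subst_word \<theta> v \<and> v \<in> inflation_factors as \<theta> k"
proof -
  obtain a u v where a: "a \<in> set as" "v \<in> (subst_words \<theta> ^^ k) {[a]}" "u \<in> subst_word \<theta> v"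
    "sublist w u"
    using w by (auto simp: inflation_factors_def subst_words_iff)
  then have "v \<in> inflation_factors as \<theta> k"
    by (auto simp: inflation_factors_def)
  then have "\<forall>b\<in>set v. \<forall>u\<in>\<theta> b. length u \<le> N"
    using inflation_factors_alphabet[OF rs] N by blast
  from sublist_subst_word_desubstitute[OF this a(3,4)] show ?thesis
    using a(1,2) unfolding inflation_factors_def by blast
qed

section \<open>Letter weights that stay bounded on all factors\<close>

definition bounded_weight :: "'a list \<Rightarrow> ('a \<Rightarrow> 'a list set) \<Rightarrow> ('a \<Rightarrow> complex) \<Rightarrow> bool" where
  "bounded_weight as \<theta> \<phi> \<longleftrightarrow>
     (\<exists>C. \<forall>k. \<forall>w\<in>inflation_factors as \<theta> k. cmod (\<Sum>x\<leftarrow>w. \<phi> x) \<le> C)"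

lemma bounded_weight_cong:
  assumes "random_substitution as \<theta>" "\<And>b. b \<in> set as \<Longrightarrow> \<phi> b = \<psi> b"
  shows "bounded_weight as \<theta> \<phi> \<longleftrightarrow> bounded_weight as \<theta> \<psi>"
proof -
  have "(\<Sum>x\<leftarrow>w. \<phi> x) = (\<Sum>x\<leftarrow>w. \<psi> x)" if "w \<in> inflation_factors as \<theta> k" for w k
    using inflation_factors_alphabet[OF assms(1) that] assms(2)
    by (metis map_cong subset_code(1))
  then show ?thesis
    by (simp add: bounded_weight_def)
qed

lemma bounded_weight_scale:
  assumes "bounded_weight as \<theta> \<phi>"
  shows "bounded_weight as \<theta> (\<lambda>x. c * \<phi> x)"
proof -
  obtain C where "\<forall>k. \<forall>w\<in>inflation_factors as \<theta> k. cmod (\<Sum>x\<leftarrow>w. \<phi> x) \<le> C"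
    using assms by (auto simp: bounded_weight_def)
  then show ?thesis
    unfolding bounded_weight_def
    by (intro exI[of _ "cmod c * C"])
       (auto simp: sum_list_const_mult norm_mult intro!: mult_left_mono)
qed

lemma bounded_weight_add:
  assumes "bounded_weight as \<theta> \<phi>" "bounded_weight as \<theta> \<psi>"
  shows "bounded_weight as \<theta> (\<lambda>x. \<phi> x + \<psi> x)"
proof -
  obtain C D where "\<forall>k. \<forall>w\<in>inflation_factors as \<theta> k. cmod (\<Sum>x\<leftarrow>w. \<phi> x) \<le> C"
    and "\<forall>k. \<forall>w\<in>inflation_factors as \<theta> k. cmod (\<Sum>x\<leftarrow>w. \<psi> x) \<le> D"
    using assms by (auto simp: bounded_weight_def)
  then show ?thesis
    unfolding bounded_weight_def
    by (intro exI[of _ "C + D"]) (auto simp: sum_list_addf intro!: norm_triangle_mono)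
qed

lemma bounded_weight_sum:
  assumes "finite I" "\<And>i. i \<in> I \<Longrightarrow> bounded_weight as \<theta> (\<phi> i)"
  shows "bounded_weight as \<theta> (\<lambda>x. \<Sum>i\<in>I. c i * \<phi> i x)"
  using assms
proof (induction I rule: finite_induct)
  case empty
  then show ?case by (auto simp: bounded_weight_def)
next
  case (insert i I)
  then show ?case
    by (simp add: bounded_weight_add bounded_weight_scale)
qed

lemma norm_weight_le:
  fixes \<phi> :: "'a \<Rightarrow> complex"
  assumes "\<forall>x\<in>set w. cmod (\<phi> x) \<le> K" "0 \<le> K" "length w \<le> n"
  shows "cmod (\<Sum>x\<leftarrow>w. \<phi> x) \<le> real n * K"
proof -
  have "cmod (\<Sum>x\<leftarrow>w. \<phi> x) \<le> real (length w) * K"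
    using assms(1)
  proof (induction w)
    case (Cons x w)
    then show ?case
      using norm_triangle_mono[of "\<phi> x" K "\<Sum>x\<leftarrow>w. \<phi> x" "real (length w) * K"]
      by (simp add: algebra_simps)
  qed simp
  also have "\<dots> \<le> real n * K"
    using assms by (intro mult_right_mono) auto
  finally show ?thesis .
qed

text \<open>
  Weights are additive, so an identity for the images of single letters extends to words.
\<close>

lemma weight_subst_word:
  fixes \<phi> :: "'a \<Rightarrow> complex"
  assumes "\<And>b u. b \<in> set v \<Longrightarrow> u \<in> \<theta> b \<Longrightarrow> (\<Sum>x\<leftarrow>u. \<phi> x) = \<psi> b"
    and "x \<in> subst_word \<theta> v"
  shows "(\<Sum>y\<leftarrow>x. \<phi> y) = (\<Sum>b\<leftarrow>v. \<psi> b)"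
proof -
  obtain us where "list_all2 (\<lambda>x b. x \<in> \<theta> b) us v" "x = concat us"
    using assms(2) by (auto simp: subst_word_iff)
  then show ?thesis
    using assms(1)
    by (induction us v arbitrary: x rule: list_all2_induct) auto
qed

text \<open>
  Write a factor of level \<open>k + 1\<close> as \<open>s x p\<close> with \<open>x\<close> in \<open>\<theta>(v)\<close> and
  \<open>v\<close> a factor of level \<open>k\<close>.  A bound \<open>C\<close> for level \<open>k\<close> gives the bound
  \<open>|\<mu>| C + E\<close> for level \<open>k + 1\<close>, where \<open>E\<close> collects \<open>s\<close>, \<open>p\<close> and
  \<open>\<psi>\<close>.  As \<open>|\<mu>| < 1\<close>, any \<open>C\<close> above the fixed point \<open>E / (1 - |\<mu>|)\<close>
  of this recursion reproduces itself.
\<close>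

lemma bounded_weight_contraction:
  assumes rs: "random_substitution as \<theta>" and \<mu>: "cmod \<mu> < 1"
    and \<psi>: "bounded_weight as \<theta> \<psi>"
    and \<phi>: "\<And>b u. b \<in> set as \<Longrightarrow> u \<in> \<theta> b \<Longrightarrow> (\<Sum>x\<leftarrow>u. \<phi> x) = \<mu> * \<phi> b + \<psi> b"
  shows "bounded_weight as \<theta> \<phi>"
proof -
  obtain N where N: "\<forall>b\<in>set as. \<forall>u\<in>\<theta> b. length u \<le> N"
    using image_lengths_bounded[OF rs] by blast
  obtain D where D: "\<forall>k. \<forall>w\<in>inflation_factors as \<theta> k. cmod (\<Sum>x\<leftarrow>w. \<psi> x) \<le> D"
    using \<psi> by (auto simp: bounded_weight_def)
  define K where "K = (\<Sum>a\<in>set as. cmod (\<phi> a))"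
  have K0: "0 \<le> K"
    by (simp add: K_def sum_nonneg)
  have K: "\<forall>a\<in>set as. cmod (\<phi> a) \<le> K"
    unfolding K_def by (auto intro: member_le_sum)
  define E where "E = 2 * real N * K + \<bar>D\<bar>"
  \<comment> \<open>The summand \<open>K\<close> covers level \<open>0\<close>, where factors have at most one letter.\<close>
  define C where "C = K + E / (1 - cmod \<mu>)"
  have E0: "0 \<le> E"
    using K0 by (simp add: E_def)
  have "E + cmod \<mu> * C = K * cmod \<mu> + E / (1 - cmod \<mu>)"
    using \<mu> by (simp add: C_def field_simps)
  also have "\<dots> \<le> C"
    using \<mu> K0 by (simp add: C_def mult_left_le)
  finally have step: "E + cmod \<mu> * C \<le> C" .
  have "cmod (\<Sum>x\<leftarrow>w. \<phi> x) \<le> C" if "w \<in> inflation_factors as \<theta> k" for w k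
    using that
  proof (induction k arbitrary: w)
    case 0
    then obtain a where a: "a \<in> set as" "sublist w [a]"
      by (auto simp: inflation_factors_def)
    then have "length w \<le> 1"
      by (auto dest: sublist_length_le)
    moreover have "\<forall>x\<in>set w. cmod (\<phi> x) \<le> K"
      using K inflation_factors_alphabet[OF rs 0] by blast
    ultimately have "cmod (\<Sum>x\<leftarrow>w. \<phi> x) \<le> K"
      using norm_weight_le[of w \<phi> K 1] K0 by simp
    also have "K \<le> C"
      using E0 \<mu> by (simp add: C_def)
    finally show ?case .
  next
    case (Suc k)
    obtain s x p v where w: "w = s @ x @ p" and len: "length s \<le> N" "length p \<le> N"
      and x: "x \<in> subst_word \<theta> v" and v: "v \<in> inflation_factors as \<theta> k"
      using inflation_factors_Suc[OF rs N Suc.prems] by blast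
    have letters: "\<forall>y\<in>set w. cmod (\<phi> y) \<le> K"
      using K inflation_factors_alphabet[OF rs Suc.prems] by blast
    have "(\<Sum>y\<leftarrow>x. \<phi> y) = (\<Sum>b\<leftarrow>v. \<mu> * \<phi> b + \<psi> b)"
      using inflation_factors_alphabet[OF rs v] by (intro weight_subst_word[OF _ x] \<phi>) auto
    also have "\<dots> = \<mu> * (\<Sum>b\<leftarrow>v. \<phi> b) + (\<Sum>b\<leftarrow>v. \<psi> b)"
      by (simp add: sum_list_addf sum_list_const_mult)
    also have "cmod \<dots> \<le> cmod \<mu> * C + \<bar>D\<bar>"
      using Suc.IH[OF v] D v
      by (intro norm_triangle_mono) (force simp: norm_mult intro: mult_left_mono)+
    finally have "cmod (\<Sum>y\<leftarrow>x. \<phi> y) \<le> cmod \<mu> * C + \<bar>D\<bar>" .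
    moreover have "cmod (\<Sum>y\<leftarrow>s. \<phi> y) \<le> real N * K" "cmod (\<Sum>y\<leftarrow>p. \<phi> y) \<le> real N * K"
      using letters len K0 by (auto intro!: norm_weight_le simp: w)
    ultimately have "cmod ((\<Sum>y\<leftarrow>s. \<phi> y) + ((\<Sum>y\<leftarrow>x. \<phi> y) + (\<Sum>y\<leftarrow>p. \<phi> y)))
        \<le> real N * K + ((cmod \<mu> * C + \<bar>D\<bar>) + real N * K)"
      by (intro norm_triangle_mono)
    also have "\<dots> = E + cmod \<mu> * C"
      by (simp add: E_def)
    also have "\<dots> \<le> C" by (rule step)
    finally show ?case by (simp add: w)
  qed
  then show ?thesis
    unfolding bounded_weight_def by blast
qed

section \<open>The spectrum of the substitution matrix\<close>

text \<open>
  In characteristic zero an irreducible polynomial is coprime to its derivative, and a Bezout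
  identity over the rationals excludes a common root over the complex numbers as well.
\<close>

lemma irreducible_rat_poly_simple_root:
  fixes z :: complex
  assumes "irreducible p" "poly (map_poly of_rat p) z = 0"
  shows "poly (pderiv (map_poly of_rat p)) z \<noteq> 0"
proof
  interpret hom: map_poly_comm_ring_hom "of_rat :: rat \<Rightarrow> complex" ..
  assume *: "poly (pderiv (map_poly of_rat p)) z = 0"
  have deg: "degree p > 0"
    using assms(1) is_unit_iff_degree[of p] by (auto simp: irreducible_def)
  then have p': "pderiv p \<noteq> 0"
    by (simp add: pderiv_eq_0_iff)
  have "\<not> p dvd pderiv p"
    using dvd_imp_degree_le[of p "pderiv p"] p' deg by (auto simp: degree_pderiv)
  then have "coprime p (pderiv p)"
    using assms(1) by (intro prime_elem_imp_coprime irreducible_imp_prime_elem)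
  then obtain a b where "a * p + b * pderiv p = 1"
    by (metis bezout_coefficients_fst_snd coprime_iff_gcd_eq_1)
  then have "map_poly (of_rat :: rat \<Rightarrow> complex) (a * p + b * pderiv p) = 1"
    by simp
  then have "map_poly of_rat a * map_poly of_rat p
      + map_poly of_rat b * pderiv (map_poly of_rat p) = (1 :: complex poly)"
    by (simp add: hom.hom_add hom.hom_mult of_rat_hom.map_poly_pderiv)
  then have "poly (map_poly of_rat a) z * poly (map_poly of_rat p) z
      + poly (map_poly of_rat b) z * poly (pderiv (map_poly of_rat p)) z = 1"
    by (metis poly_1 poly_add poly_mult)
  then show False
    using assms(2) * by simp
qed

text \<open>
  Since the characteristic polynomial is irreducible, monic and vanishes at \<open>l\<close>, it is the
  minimal polynomial of \<open>l\<close>.  Its other roots are thus the conjugates that the Pisot property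
  controls, and \<open>l\<close> is not repeated among them because it is a simple root.
\<close>

lemma pisot_char_poly_factorization:
  fixes M :: "nat mat"
  assumes M: "M \<in> carrier_mat n n"
    and irr: "irreducible (char_poly (map_mat of_nat M :: rat mat))"
    and ev: "eigenvalue (map_mat of_nat M :: complex mat) (of_real l)"
    and pisot: "pisot_number l"
  shows "\<exists>es. char_poly (map_mat of_nat M :: complex mat)
           = (\<Prod>e\<leftarrow>of_real l # es. [:- e, 1:]) \<and> (\<forall>e\<in>set es. cmod e < 1)"
proof -
  let ?A = "map_mat of_nat M :: complex mat"
  let ?p = "char_poly (map_mat of_nat M :: rat mat)"
  let ?l = "of_real l :: complex"
  have A: "?A \<in> carrier_mat n n" and A': "(map_mat of_nat M :: rat mat) \<in> carrier_mat n n"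
    using M by auto
  have "map_mat of_rat (map_mat of_nat M :: rat mat) = ?A"
    by (rule eq_matI) auto
  then have p: "map_poly of_rat ?p = char_poly ?A"
    using of_rat_hom.char_poly_hom[OF A', where ?'a = complex] by simp
  have root: "poly (char_poly ?A) ?l = 0"
    using ev eigenvalue_root_char_poly[OF A] by simp
  obtain fs where fs: "char_poly ?A = (\<Prod>e\<leftarrow>fs. [:- e, 1:])"
    using char_poly_factorized[OF A] by blast
  have "?l \<in> set fs"
    using root unfolding fs poly_prod_list by (auto simp: prod_list_zero_iff)
  then obtain ys zs where "fs = ys @ ?l # zs"
    by (meson split_list)
  then have fac: "char_poly ?A = (\<Prod>e\<leftarrow>?l # (ys @ zs). [:- e, 1:])"
    by (simp only: fs map_append prod_list.append list.map prod_list.Cons mult.left_commute)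
  have "cmod e < 1" if e: "e \<in> set (ys @ zs)" for e
  proof -
    let ?q = "\<Prod>e\<leftarrow>ys @ zs. [:- e, 1:]"
    have q0: "poly ?q e = 0"
      unfolding poly_prod_list using e by (auto simp: prod_list_zero_iff)
    have "poly (pderiv (char_poly ?A)) ?l \<noteq> 0"
      using irreducible_rat_poly_simple_root[OF irr, of ?l] root p by simp
    moreover have "char_poly ?A = [:- ?l, 1:] * ?q"
      unfolding fac by (simp only: list.map prod_list.Cons)
    then have "poly (pderiv (char_poly ?A)) ?l = poly ?q ?l"
      by (simp only: pderiv_mult pderiv_pCons) simp
    ultimately have "poly ?q ?l \<noteq> 0"
      by simp
    then have "e \<noteq> ?l"
      using q0 by auto
    moreover have "algebraic_conjugate ?l e"
    proof -
      have "poly (map_poly of_rat ?p) e = 0"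
        unfolding p fac using q0 by simp
      moreover have "minimal_poly ?l ?p"
        unfolding minimal_poly_def using irr root p degree_monic_char_poly[OF A'] by simp
      ultimately show ?thesis
        unfolding algebraic_conjugate_def by blast
    qed
    ultimately show ?thesis
      using pisot unfolding pisot_number_def by blast
  qed
  then show ?thesis
    using fac by blast
qed

text \<open>
  The Schur decomposition \<open>A = P B Q\<close> read from the left: row \<open>i\<close> of \<open>Q\<close> times
  \<open>A\<close> is a combination of the rows \<open>m \<ge> i\<close> of \<open>Q\<close>.  The order of the diagonal of
  \<open>B\<close> can be prescribed, which is what allows the dominant eigenvalue to be put first.
\<close>

lemma triangular_left_basis:
  fixes A :: "complex mat"
  assumes A: "A \<in> carrier_mat n n" and cp: "char_poly A = (\<Prod>e\<leftarrow>es. [:- e, 1:])"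
  obtains B P Q where "B \<in> carrier_mat n n" "P \<in> carrier_mat n n" "Q \<in> carrier_mat n n"
    "P * Q = 1\<^sub>m n" "Q * A = B * Q" "upper_triangular B" "diag_mat B = es"
proof -
  obtain B P Q where s: "schur_decomposition A es = (B, P, Q)"
    by (metis prod_cases3)
  have *: "similar_mat_wit A B P Q" "upper_triangular B" "diag_mat B = es"
    using schur_decomposition[OF A cp s] by auto
  have c: "B \<in> carrier_mat n n" "P \<in> carrier_mat n n" "Q \<in> carrier_mat n n"
    and PQ: "P * Q = 1\<^sub>m n" and QP: "Q * P = 1\<^sub>m n" and A_eq: "A = P * B * Q"
    using similar_mat_witD2[OF A *(1)] by auto
  have "Q * A = Q * (P * (B * Q))"
    using A_eq c by simp
  also have "\<dots> = (Q * P) * (B * Q)"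
    using c by (intro assoc_mult_mat[symmetric]) auto
  also have "\<dots> = B * Q"
    using c QP by (metis left_mult_one_mat mult_carrier_mat)
  finally show ?thesis
    using that c PQ * by blast
qed

section \<open>Letter frequencies with bounded deviation\<close>

lemma subst_mat_entry:
  assumes "compatible as \<theta>" "i < length as" "j < length as" "u \<in> \<theta> (as ! j)"
  shows "subst_mat as \<theta> $$ (i, j) = count_list u (as ! i)"
proof -
  have "subst_mat as \<theta> $$ (i, j) = (THE n. \<forall>w\<in>\<theta> (as ! j). count_list w (as ! i) = n)"
    using assms(2,3) by (simp add: subst_mat_def)
  also have "\<dots> = count_list u (as ! i)"
  proof (rule the_equality)
    show "\<forall>w\<in>\<theta> (as ! j). count_list w (as ! i) = count_list u (as ! i)"
      using assms(1,4) nth_mem[OF assms(2)] nth_mem[OF assms(3)]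
      unfolding compatible_def by blast
  next
    fix n assume "\<forall>w\<in>\<theta> (as ! j). count_list w (as ! i) = n"
    then show "n = count_list u (as ! i)"
      using assms(4) by simp
  qed
  finally show ?thesis .
qed

lemma weight_eq_sum_nth:
  fixes \<phi> :: "'a \<Rightarrow> complex"
  assumes "distinct as" "set u \<subseteq> set as"
  shows "(\<Sum>x\<leftarrow>u. \<phi> x) = (\<Sum>m<length as. of_nat (count_list u (as ! m)) * \<phi> (as ! m))"
proof -
  have "(\<Sum>x\<leftarrow>u. \<phi> x) = (\<Sum>x\<in>set as. of_nat (count_list u x) * \<phi> x)"
    using assms(2)
  proof (induction u)
    case (Cons y u)
    have "(\<Sum>x\<in>set as. of_nat (count_list (y # u) x) * \<phi> x)
        = (\<Sum>x\<in>set as. (if y = x then \<phi> x else 0) + of_nat (count_list u x) * \<phi> x)"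
      by (intro sum.cong) (auto simp: algebra_simps)
    also have "\<dots> = \<phi> y + (\<Sum>x\<in>set as. of_nat (count_list u x) * \<phi> x)"
      using Cons.prems by (simp add: sum.distrib)
    finally show ?case
      using Cons by simp
  qed simp
  also have "\<dots> = (\<Sum>m<length as. of_nat (count_list u (as ! m)) * \<phi> (as ! m))"
    using bij_betw_nth[OF assms(1) refl refl] by (rule sum.reindex_bij_betw[symmetric])
  finally show ?thesis .
qed

text \<open>
  The weights are the rows of \<open>Q\<close>, read as functions on the alphabet.  They span because
  \<open>P Q = 1\<close>.  Row \<open>i\<close> is multiplied by the \<open>i\<close>-th diagonal entry up to a combination of
  later rows, and for \<open>i > 0\<close> that entry lies in \<open>es\<close>, so the contraction lemma applies from
  the last row upwards.
\<close>

lemma weight_basis: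
  fixes as :: "'a list"
  assumes rs: "random_substitution as \<theta>" and comp: "compatible as \<theta>"
    and cp: "char_poly (map_mat of_nat (subst_mat as \<theta>)) = (\<Prod>e\<leftarrow>l # es. [:- e, 1 :: complex:])"
    and es: "\<forall>e\<in>set es. cmod e < 1"
  shows "\<exists>q :: nat \<Rightarrow> 'a \<Rightarrow> complex.
           (\<forall>i. 0 < i \<and> i < length as \<longrightarrow> bounded_weight as \<theta> (q i)) \<and>
           (\<forall>\<phi>. \<exists>c. \<forall>x\<in>set as. \<phi> x = (\<Sum>i<length as. c i * q i x))"
proof -
  define n where "n = length as"
  let ?A = "map_mat of_nat (subst_mat as \<theta>) :: complex mat"
  have dist: "distinct as"
    using rs by (simp add: random_substitution_def)
  have A: "?A \<in> carrier_mat n n"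
    by (simp add: subst_mat_def n_def)
  obtain B P Q where B: "B \<in> carrier_mat n n" and P: "P \<in> carrier_mat n n"
    and Q: "Q \<in> carrier_mat n n" and PQ: "P * Q = 1\<^sub>m n" and QA: "Q * ?A = B * Q"
    and ut: "upper_triangular B" and diag: "diag_mat B = l # es"
    by (rule triangular_left_basis[OF A cp])
  obtain idx where idx: "idx (as ! j) = j" if "j < n" for j
    using dist inj_on_nth[of as "{..<n}"] the_inv_into_f_f[of "nth as" "{..<n}"]
    unfolding n_def by (metis lessThan_iff)
  define q where "q i x = Q $$ (i, idx x)" for i x
  have span: "\<exists>c. \<forall>x\<in>set as. \<phi> x = (\<Sum>i<length as. c i * q i x)" for \<phi>
  proof (intro exI ballI)
    fix x assume "x \<in> set as"
    then obtain j where j: "x = as ! j" "j < n"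
      by (auto simp: in_set_conv_nth n_def)
    have PQ_entry: "(\<Sum>i<n. P $$ (m, i) * Q $$ (i, j)) = (if m = j then 1 else 0)"
      if "m < n" for m
    proof -
      have "(P * Q) $$ (m, j) = (\<Sum>i<n. P $$ (m, i) * Q $$ (i, j))"
        using P Q j(2) that by (simp add: scalar_prod_def atLeast0LessThan)
      then show ?thesis
        using PQ j(2) that by simp
    qed
    have "(\<Sum>i<n. (\<Sum>m<n. \<phi> (as ! m) * P $$ (m, i)) * q i x)
        = (\<Sum>m<n. \<phi> (as ! m) * (\<Sum>i<n. P $$ (m, i) * Q $$ (i, j)))"
      unfolding sum_distrib_left sum_distrib_right
      by (subst sum.swap) (simp add: q_def j idx mult.assoc)
    also have "\<dots> = (\<Sum>m<n. if m = j then \<phi> (as ! m) else 0)"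
      by (intro sum.cong) (auto simp: PQ_entry)
    also have "\<dots> = \<phi> x"
      using j by simp
    finally show "\<phi> x = (\<Sum>i<length as. (\<Sum>m<n. \<phi> (as ! m) * P $$ (m, i)) * q i x)"
      by (simp add: n_def)
  qed
  have image: "(\<Sum>x\<leftarrow>u. q i x) = B $$ (i, i) * q i b + (\<Sum>m\<in>{i<..<n}. B $$ (i, m) * q m b)"
    if i: "i < n" and b: "b \<in> set as" and u: "u \<in> \<theta> b" for i b u
  proof -
    obtain j where j: "b = as ! j" "j < n"
      using b by (auto simp: in_set_conv_nth n_def)
    have "set u \<subseteq> set as"
      using rs b u by (fastforce simp: random_substitution_def)
    then have "(\<Sum>x\<leftarrow>u. q i x) = (\<Sum>m<n. of_nat (count_list u (as ! m)) * q i (as ! m))"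
      unfolding n_def by (rule weight_eq_sum_nth[OF dist])
    also have "\<dots> = (\<Sum>m<n. Q $$ (i, m) * ?A $$ (m, j))"
      using u j A subst_mat_entry[OF comp, of _ j u]
      by (intro sum.cong) (auto simp: q_def idx n_def)
    also have "\<dots> = (Q * ?A) $$ (i, j)"
      using Q A i j(2) by (simp add: scalar_prod_def atLeast0LessThan)
    also have "\<dots> = (\<Sum>m<n. B $$ (i, m) * q m b)"
      unfolding QA using Q B i j
      by (simp add: scalar_prod_def atLeast0LessThan q_def idx)
    also have "\<dots> = (\<Sum>m\<in>{i..<n}. B $$ (i, m) * q m b)"
      using i B upper_triangularD[OF ut] by (intro sum.mono_neutral_right) auto
    also have "{i..<n} = insert i {i<..<n}"
      using i by auto
    finally show ?thesis
      by simp
  qed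
  have "bounded_weight as \<theta> (q i)" if "0 < i" "i < n" for i
    using that
  proof (induction "n - i" arbitrary: i rule: less_induct)
    case less
    have "B $$ (i, i) = (l # es) ! i" and "length (l # es) = n"
      using B less.prems unfolding diag[symmetric] by (auto simp: diag_mat_def)
    then have "B $$ (i, i) \<in> set es"
      using less.prems by (cases i) auto
    then have "cmod (B $$ (i, i)) < 1"
      using es by blast
    moreover have "bounded_weight as \<theta> (\<lambda>b. \<Sum>m\<in>{i<..<n}. B $$ (i, m) * q m b)"
      using less by (intro bounded_weight_sum) auto
    ultimately show ?case
      by (rule bounded_weight_contraction[OF rs]) (rule image[OF less.prems(2)])
  qed
  then show ?thesis
    using span unfolding n_def by blast
qed

text \<open>
  Expand the constant weight \<open>1\<close> and the indicator of \<open>a\<close> in the basis above, with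
  coefficients \<open>s\<close> and \<open>c\<close>.  If \<open>s 0 \<noteq> 0\<close>, subtracting \<open>c 0 / s 0\<close> times the
  first expansion from the second one eliminates the only possibly unbounded weight
  \<open>q 0\<close>.  If \<open>s 0 = 0\<close>, the length itself is bounded on factors, and \<open>t = 0\<close> will do.
\<close>

lemma letter_frequency:
  assumes rs: "random_substitution as \<theta>" and comp: "compatible as \<theta>"
    and cp: "char_poly (map_mat of_nat (subst_mat as \<theta>)) = (\<Prod>e\<leftarrow>l # es. [:- e, 1 :: complex:])"
    and es: "\<forall>e\<in>set es. cmod e < 1"
  shows "\<exists>t. bounded_weight as \<theta> (\<lambda>x. (if x = a then 1 else 0) - t)"
proof -
  let ?\<chi> = "\<lambda>x. if x = a then 1 else 0 :: complex"
  obtain q where q: "\<And>i. 0 < i \<Longrightarrow> i < length as \<Longrightarrow> bounded_weight as \<theta> (q i)"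
    and span: "\<And>\<phi>. \<exists>c. \<forall>x\<in>set as. \<phi> x = (\<Sum>i<length as. c i * q i x)"
    using weight_basis[OF rs comp cp es] by blast
  define n where "n = length as"
  have n: "{..<n} = insert 0 {0<..<n}"
    using rs by (auto simp: random_substitution_def n_def)
  have tail: "bounded_weight as \<theta> (\<lambda>x. \<Sum>i\<in>{0<..<n}. c i * q i x)" for c
    using q by (intro bounded_weight_sum) (auto simp: n_def)
  have span': "\<exists>c. \<forall>x\<in>set as. \<phi> x = c 0 * q 0 x + (\<Sum>i\<in>{0<..<n}. c i * q i x)" for \<phi>
    using span[of \<phi>] unfolding n_def[symmetric] n by simp
  obtain c where c: "\<forall>x\<in>set as. ?\<chi> x = c 0 * q 0 x + (\<Sum>i\<in>{0<..<n}. c i * q i x)"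
    using span'[of ?\<chi>] by blast
  obtain s where s: "\<forall>x\<in>set as. s 0 * q 0 x + (\<Sum>i\<in>{0<..<n}. s i * q i x) = 1"
    using span'[of "\<lambda>_. 1"] by metis
  show ?thesis
  proof (cases "s 0 = 0")
    case True
    then have "bounded_weight as \<theta> (\<lambda>_. 1)"
      using s tail[of s] by (subst bounded_weight_cong[OF rs, symmetric]) auto
    then obtain C where C: "\<forall>k. \<forall>w\<in>inflation_factors as \<theta> k. real (length w) \<le> C"
      by (auto simp: bounded_weight_def sum_list_triv)
    have "cmod (\<Sum>x\<leftarrow>w. ?\<chi> x - 0) \<le> real (length w)" for w
      using norm_weight_le[of w "\<lambda>x. ?\<chi> x - 0" 1 "length w"] by simp
    then have "bounded_weight as \<theta> (\<lambda>x. ?\<chi> x - 0)"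
      unfolding bounded_weight_def using C by (meson order_trans)
    then show ?thesis by blast
  next
    case False
    define t where "t = c 0 / s 0"
    have "?\<chi> x - t = (\<Sum>i\<in>{0<..<n}. (c i - t * s i) * q i x)" if "x \<in> set as" for x
    proof -
      have "?\<chi> x - t = (c 0 * q 0 x + (\<Sum>i\<in>{0<..<n}. c i * q i x))
          - t * (s 0 * q 0 x + (\<Sum>i\<in>{0<..<n}. s i * q i x))"
        using c s that by simp
      also have "\<dots> = (c 0 - t * s 0) * q 0 x
          + ((\<Sum>i\<in>{0<..<n}. c i * q i x) - t * (\<Sum>i\<in>{0<..<n}. s i * q i x))"
        by (simp add: algebra_simps)
      also have "c 0 - t * s 0 = 0"
        using False by (simp add: t_def)
      finally show ?thesis
        by (simp add: algebra_simps sum_distrib_left sum_subtractf)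
    qed
    then have "bounded_weight as \<theta> (\<lambda>x. ?\<chi> x - t)"
      using tail[of "\<lambda>i. c i - t * s i"] by (subst bounded_weight_cong[OF rs]) auto
    then show ?thesis by blast
  qed
qed

lemma language_subset_inflation_factors:
  assumes "w \<in> language (rs_subshift as \<theta>)"
  shows "\<exists>k. w \<in> inflation_factors as \<theta> k"
proof -
  obtain x i n where "x \<in> rs_subshift as \<theta>" "w = factor x i n"
    using assms unfolding language_def by blast
  then have "legal as \<theta> w"
    by (simp add: rs_subshift_def)
  then obtain k a u where "a \<in> set as" "u \<in> (subst_words \<theta> ^^ k) {[a]}" "sublist w u"
    unfolding legal_def by metis
  then have "w \<in> inflation_factors as \<theta> k"
    by (auto simp only: inflation_factors_def)
  then show ?thesis ..
qed

theorem theorem33: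
  fixes as :: "'a list" and \<theta> :: "'a \<Rightarrow> 'a list set"
  assumes "random_substitution as \<theta>"
    and "compatible as \<theta>"
    and "primitive_subst as \<theta>"
    and "irreducible_subst as \<theta>"
    and "pisot_subst as \<theta>"
  shows "\<exists>C. balanced as (rs_subshift as \<theta>) C"
proof -
  have carrier: "subst_mat as \<theta> \<in> carrier_mat (length as) (length as)"
    by (simp add: subst_mat_def)
  have irr: "irreducible (char_poly (map_mat of_nat (subst_mat as \<theta>) :: rat mat))"
    using assms(4) by (simp add: irreducible_subst_def)
  obtain l where "pisot_number l"
    and "eigenvalue (map_mat of_nat (subst_mat as \<theta>) :: complex mat) (of_real l)"
    using assms(5) by (auto simp: pisot_subst_def perron_frobenius_eigenvalue_def)
  then obtain es where
    "char_poly (map_mat of_nat (subst_mat as \<theta>) :: complex mat) = (\<Prod>e\<leftarrow>of_real l # es. [:- e, 1:])"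
    and "\<forall>e\<in>set es. cmod e < 1"
    using pisot_char_poly_factorization[OF carrier irr] by blast
  then have "\<forall>a. \<exists>t. bounded_weight as \<theta> (\<lambda>x. (if x = a then 1 else 0) - t)"
    using letter_frequency[OF assms(1,2)] by blast
  then obtain t C where C: "\<And>a k w. w \<in> inflation_factors as \<theta> k \<Longrightarrow>
      cmod (\<Sum>x\<leftarrow>w. (if x = a then 1 else 0) - t a) \<le> C a"
    unfolding bounded_weight_def by metis
  have weight: "(\<Sum>x\<leftarrow>w. (if x = a then 1 else 0) - t a)
      = of_nat (count_list w a) - of_nat (length w) * t a" for w a
    by (induction w) (auto simp: algebra_simps)
  have diff: "\<bar>real (count_list w a) - real (count_list w' a)\<bar> \<le> 2 * C a"
    if w: "w \<in> language (rs_subshift as \<theta>)" "w' \<in> language (rs_subshift as \<theta>)"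
      and len: "length w = length w'" for a w w'
  proof -
    let ?r = "\<lambda>w. of_nat (count_list w a) - of_nat (length w) * t a"
    have "cmod (?r w) \<le> C a" "cmod (?r w') \<le> C a"
      using C[of _ _ a] w[THEN language_subset_inflation_factors] unfolding weight by blast+
    then have "cmod (?r w - ?r w') \<le> C a + C a"
      by (rule norm_triangle_le_diff[OF add_mono])
    also have "?r w - ?r w' = of_real (real (count_list w a) - real (count_list w' a))"
      by (simp add: len)
    finally show ?thesis
      unfolding norm_of_real by simp
  qed
  have "balanced as (rs_subshift as \<theta>) (\<Sum>a\<in>set as. \<bar>2 * C a\<bar>)"
    unfolding balanced_def
  proof (intro ballI impI)
    fix a w w'
    assume *: "a \<in> set as" "w \<in> language (rs_subshift as \<theta>)" "w' \<in> language (rs_subshift as \<theta>)"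
      "length w = length w'"
    have "\<bar>real (count_list w a) - real (count_list w' a)\<bar> \<le> \<bar>2 * C a\<bar>"
      using diff[OF *(2-4), of a] by linarith
    also have "\<dots> \<le> (\<Sum>a\<in>set as. \<bar>2 * C a\<bar>)"
      using *(1) by (intro member_le_sum) auto
    finally show "\<bar>real (count_list w a) - real (count_list w' a)\<bar> \<le> (\<Sum>a\<in>set as. \<bar>2 * C a\<bar>)" .
  qed
  then show ?thesis ..
qed

end
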